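(* Let $G$ be a permutation group on a finite set of order $n$. Then $|G:G^*| \leq 2^{n-1}$ and $|G:G^S| \leq \lambda^{n-1}$.
   Context: For a finite group $G$, $G^*$ denotes the normal subgroup of $G$ such that $G/G^*$ is the maximum nilpotent quotient of $G$ (i.e. the smallest normal subgroup of $G$ with nilpotent quotient), and $G^S$ denotes the normal subgroup of $G$ such that $G/G^S$ is the maximum solvable quotient of $G$ (i.e. the smallest normal subgroup of $G$ with solvable quotient). The constant is $\lambda = 24^{1/3}$. A permutation group on a set is a subgroup of the symmetric group of that set. *)

theory Defs
  imports Complex_Main "HOL-Algebra.Algebra"
begin

primrec lower_central :: "('a, 'b) monoid_scheme \<Rightarrow> nat \<Rightarrow> 'a set" where
  "lower_central G 0 = carrier G"
| "lower_central G (Suc k) =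
     generate G (\<Union>x \<in> lower_central G k. \<Union>y \<in> carrier G.
       {x \<otimes>\<^bsub>G\<^esub> y \<otimes>\<^bsub>G\<^esub> inv\<^bsub>G\<^esub> x \<otimes>\<^bsub>G\<^esub> inv\<^bsub>G\<^esub> y})"

definition nilpotent :: "('a, 'b) monoid_scheme \<Rightarrow> bool" where
  "nilpotent G \<longleftrightarrow> (\<exists>k. lower_central G k = {\<one>\<^bsub>G\<^esub>})"

text \<open>The least element is taken with respect to inclusion. It is only meaningful where such a
  least normal subgroup exists; the lemmas at the end show that this is the case for finite groups.\<close>

definition nilpotent_residual :: "('a, 'b) monoid_scheme \<Rightarrow> 'a set" where
  "nilpotent_residual G = (LEAST N. N \<lhd> G \<and> nilpotent (G Mod N))"

definition solvable_residual :: "('a, 'b) monoid_scheme \<Rightarrow> 'a set" where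
  "solvable_residual G = (LEAST N. N \<lhd> G \<and> solvable (G Mod N))"

definition lambda :: real where
  "lambda = root 3 24"


lemma (in group) lower_central_subgroup: "subgroup (lower_central G k) G"
proof (induction k)
  case 0
  show ?case by (simp add: subgroup_self)
next
  case (Suc k)
  then have "lower_central G k \<subseteq> carrier G" by (rule subgroup.subset)
  then show ?case
    unfolding lower_central.simps(2) by (intro generate_is_subgroup) blast
qed

lemma (in group) lower_central_antimono:
  assumes "k \<le> l" shows "lower_central G l \<subseteq> lower_central G k"
proof -
  have "lower_central G (Suc m) \<subseteq> lower_central G m" for m
  proof (induction m)
    case 0
    show ?case using subgroup.subset[OF lower_central_subgroup[of "Suc 0"]] by simp
  next
    case (Suc m)
    show ?case
      by (subst (1 2) lower_central.simps(2)) (intro mono_generate UN_mono Suc.IH subset_refl)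
  qed
  then show ?thesis using assms by (rule lift_Suc_antimono_le)
qed

lemma (in group_hom) lower_central_img:
  assumes "h ` carrier G = carrier H"
  shows "lower_central H k = h ` lower_central G k"
proof (induction k)
  case 0
  show ?case using assms by simp
next
  case (Suc k)
  let ?C = "\<Union>x \<in> lower_central G k. \<Union>y \<in> carrier G. {x \<otimes>\<^bsub>G\<^esub> y \<otimes>\<^bsub>G\<^esub> inv\<^bsub>G\<^esub> x \<otimes>\<^bsub>G\<^esub> inv\<^bsub>G\<^esub> y}"
  have sub: "lower_central G k \<subseteq> carrier G"
    by (rule subgroup.subset[OF G.lower_central_subgroup])
  have eq: "h (x \<otimes>\<^bsub>G\<^esub> y \<otimes>\<^bsub>G\<^esub> inv\<^bsub>G\<^esub> x \<otimes>\<^bsub>G\<^esub> inv\<^bsub>G\<^esub> y)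
      = h x \<otimes>\<^bsub>H\<^esub> h y \<otimes>\<^bsub>H\<^esub> inv\<^bsub>H\<^esub> (h x) \<otimes>\<^bsub>H\<^esub> inv\<^bsub>H\<^esub> (h y)"
    if "x \<in> lower_central G k" "y \<in> carrier G" for x y
  proof -
    have "x \<in> carrier G" using that sub by blast
    then show ?thesis using that(2) by simp
  qed
  have "(\<Union>x \<in> lower_central H k. \<Union>y \<in> carrier H.
      {x \<otimes>\<^bsub>H\<^esub> y \<otimes>\<^bsub>H\<^esub> inv\<^bsub>H\<^esub> x \<otimes>\<^bsub>H\<^esub> inv\<^bsub>H\<^esub> y}) = h ` ?C"
    unfolding Suc.IH assms[symmetric] by (simp add: image_UN eq cong: SUP_cong)
  moreover have "?C \<subseteq> carrier G" using sub by blast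
  ultimately show ?case by (simp add: generate_img)
qed

lemma normal_group_hom_Mod:
  assumes "N \<lhd> G" shows "group_hom G (G Mod N) (\<lambda>a. N #>\<^bsub>G\<^esub> a)"
proof -
  interpret normal N G by fact
  show ?thesis
    by (intro group_hom.intro group_hom_axioms.intro is_group factorgroup_is_group r_coset_hom_Mod)
qed

lemma (in group) r_coset_img_trivial_iff:
  assumes "N \<lhd> G" "subgroup K G"
  shows "(\<lambda>a. N #> a) ` K = {\<one>\<^bsub>G Mod N\<^esub>} \<longleftrightarrow> K \<subseteq> N"
proof -
  interpret N: normal N G by fact
  have K: "K \<subseteq> carrier G" "K \<noteq> {}"
    using assms(2) subgroup.subset subgroup.one_closed by blast+
  have "N #> a = N \<longleftrightarrow> a \<in> N" if "a \<in> K" for a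
    using that K N.is_subgroup by (meson coset_join1 coset_join2 subsetD)
  then show ?thesis using K(2) by auto
qed

lemma (in group) nilpotent_Mod_iff:
  assumes "N \<lhd> G"
  shows "nilpotent (G Mod N) \<longleftrightarrow> (\<exists>k. lower_central G k \<subseteq> N)"
  unfolding nilpotent_def
  using group_hom.lower_central_img[OF normal_group_hom_Mod[OF assms]]
    r_coset_img_trivial_iff[OF assms lower_central_subgroup]
  by (simp add: carrier_FactGroup)

lemma (in group) solvable_Mod_iff:
  assumes "N \<lhd> G"
  shows "solvable (G Mod N) \<longleftrightarrow> (\<exists>k. (derived G ^^ k) (carrier G) \<subseteq> N)"
  using group.solvable_iff_trivial_derived_seq[OF normal.factorgroup_is_group[OF assms]]
    group_hom.exp_of_derived_img[OF normal_group_hom_Mod[OF assms] subset_refl]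
    r_coset_img_trivial_iff[OF assms exp_of_derived_is_subgroup[OF subgroup_self]]
  by (simp add: carrier_FactGroup)

lemma finite_Inter_closed_Least:
  fixes P :: "'a set \<Rightarrow> bool"
  assumes fin: "finite A" and "P A"
    and int: "\<And>M N. P M \<Longrightarrow> P N \<Longrightarrow> P (M \<inter> N)"
  shows "P (LEAST N. P N)" and "P M \<Longrightarrow> (LEAST N. P N) \<subseteq> M"
proof -
  let ?Q = "\<lambda>N. P N \<and> N \<subseteq> A"
  obtain N where N: "?Q N" and min: "\<And>M. ?Q M \<Longrightarrow> card N \<le> card M"
    using \<open>P A\<close> exists_least_iff[of "\<lambda>m. \<exists>N. ?Q N \<and> card N = m"]
    by (metis not_le_imp_less subset_refl)
  have "N \<subseteq> M" if "P M" for M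
  proof -
    have "card N \<le> card (N \<inter> M)" using N int that by (intro min) auto
    then have "N \<inter> M = N"
      using N fin by (intro card_seteq) (auto intro: finite_subset)
    then show ?thesis by blast
  qed
  then have "(LEAST N. P N) = N" using N by (intro Least_equality) auto
  then show "P (LEAST N. P N)" "P M \<Longrightarrow> (LEAST N. P N) \<subseteq> M"
    using N \<open>\<And>M. P M \<Longrightarrow> N \<subseteq> M\<close> by auto
qed

lemma (in group)
  assumes "finite (carrier G)"
  shows nilpotent_residual_normal: "nilpotent_residual G \<lhd> G"
    and nilpotent_Mod_residual: "nilpotent (G Mod nilpotent_residual G)"
    and nilpotent_residual_least:
      "\<lbrakk>N \<lhd> G; nilpotent (G Mod N)\<rbrakk> \<Longrightarrow> nilpotent_residual G \<subseteq> N"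
proof -
  let ?P = "\<lambda>N. N \<lhd> G \<and> nilpotent (G Mod N)"
  have top: "?P (carrier G)"
    using nilpotent_Mod_iff[OF normal_self] lower_central.simps(1)[of G] normal_self by blast
  have int: "?P (M \<inter> N)" if MN: "?P M" "?P N" for M N
  proof -
    have normal: "M \<inter> N \<lhd> G" using MN normal_subgroup_intersect by blast
    obtain k l where "lower_central G k \<subseteq> M" "lower_central G l \<subseteq> N"
      using MN nilpotent_Mod_iff by meson
    then have "lower_central G (max k l) \<subseteq> M \<inter> N"
      using lower_central_antimono[of k "max k l"] lower_central_antimono[of l "max k l"] by auto
    then show ?thesis using normal nilpotent_Mod_iff by blast
  qed
  show "nilpotent_residual G \<lhd> G" "nilpotent (G Mod nilpotent_residual G)"
    "\<lbrakk>N \<lhd> G; nilpotent (G Mod N)\<rbrakk> \<Longrightarrow> nilpotent_residual G \<subseteq> N"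
    unfolding nilpotent_residual_def
    using finite_Inter_closed_Least(1)[where P = ?P, OF assms top int]
      finite_Inter_closed_Least(2)[where P = ?P and M = N, OF assms top int]
    by simp_all
qed

lemma (in group)
  assumes "finite (carrier G)"
  shows solvable_residual_normal: "solvable_residual G \<lhd> G"
    and solvable_Mod_residual: "solvable (G Mod solvable_residual G)"
    and solvable_residual_least:
      "\<lbrakk>N \<lhd> G; solvable (G Mod N)\<rbrakk> \<Longrightarrow> solvable_residual G \<subseteq> N"
proof -
  let ?D = "\<lambda>k. (derived G ^^ k) (carrier G)"
  let ?P = "\<lambda>N. N \<lhd> G \<and> solvable (G Mod N)"
  have "?D (Suc m) \<subseteq> ?D m" for m
    using derived_incl[OF subset_refl exp_of_derived_is_subgroup[OF subgroup_self]] by simp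
  then have anti: "?D l \<subseteq> ?D k" if "k \<le> l" for k l
    using that by (rule lift_Suc_antimono_le[of ?D])
  have top: "?P (carrier G)"
    using solvable_Mod_iff[OF normal_self] normal_self by (metis funpow_0 subset_refl)
  have int: "?P (M \<inter> N)" if MN: "?P M" "?P N" for M N
  proof -
    have normal: "M \<inter> N \<lhd> G" using MN normal_subgroup_intersect by blast
    obtain k l where "?D k \<subseteq> M" "?D l \<subseteq> N" using MN solvable_Mod_iff by meson
    then have "?D (max k l) \<subseteq> M \<inter> N"
      using anti[of k "max k l"] anti[of l "max k l"] by auto
    then show ?thesis using normal solvable_Mod_iff by blast
  qed
  show "solvable_residual G \<lhd> G" "solvable (G Mod solvable_residual G)"
    "\<lbrakk>N \<lhd> G; solvable (G Mod N)\<rbrakk> \<Longrightarrow> solvable_residual G \<subseteq> N"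
    unfolding solvable_residual_def
    using finite_Inter_closed_Least(1)[where P = ?P, OF assms top int]
      finite_Inter_closed_Least(2)[where P = ?P and M = N, OF assms top int]
    by simp_all
qed

end

theory Submission
  imports Defs
begin

text \<open>
  Both inequalities are instances of one induction on the degree. Let a finite group \<open>G\<close> act on a
  finite set, let \<open>N\<close> be a normal subgroup containing the kernel and suppose that \<open>G/N\<close> belongs to a
  class of groups closed under subgroups and quotients. Splitting the set into invariant parts, or
  passing to a block system, factors the index of \<open>N\<close> as
  \<open>|G : N| = |G : NK| |K : N \<inter> K|\<close> for the kernel \<open>K\<close> of a smaller action. If \<open>N\<close> is transitive, then
  \<open>G = N G\<^sub>x\<close>, and the point stabilizer \<open>G\<^sub>x\<close> acts on one point less. In the remaining case \<open>N\<close> is the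
  kernel and every normal subgroup outside \<open>N\<close> is transitive. The last term \<open>A\<close> outside \<open>N\<close> of the
  lower central or derived series is then transitive and abelian modulo \<open>N\<close>. In the nilpotent case
  \<open>A\<close> is even central, so \<open>|G : N| = n \<le> 2\<^bsup>n-1\<^esup>\<close>. In the solvable case \<open>A\<close> acts regularly, so the
  number of fixed points at least doubles whenever a further point is stabilized; this gives
  \<open>|G : N| \<le> n (n - 1)(n - 2)(n - 4) \<dots>\<close> with at most \<open>log\<^sub>2 n\<close> factors after the first, and this
  product is at most \<open>24\<^bsup>(n-1)/3\<^esup>\<close>.
\<close>

section \<open>Finite group actions\<close>

text \<open>The action need not be faithful: the induction passes to invariant subsets and to
  blocks, where more elements act trivially. For the same reason the laws are required only on
  \<open>E\<close>.\<close>

locale finite_action = group G for G (structure) +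
  fixes E :: "'e set" and act :: "'a \<Rightarrow> 'e \<Rightarrow> 'e"
  assumes finite_carrier: "finite (carrier G)" and finite_space: "finite E"
    and act_closed: "\<lbrakk>g \<in> carrier G; e \<in> E\<rbrakk> \<Longrightarrow> act g e \<in> E"
    and act_one: "e \<in> E \<Longrightarrow> act \<one> e = e"
    and act_mult: "\<lbrakk>g \<in> carrier G; h \<in> carrier G; e \<in> E\<rbrakk> \<Longrightarrow> act (g \<otimes> h) e = act g (act h e)"
begin

definition kernel_on :: "'e set \<Rightarrow> 'a set" where
  "kernel_on F = {g \<in> carrier G. \<forall>e \<in> F. act g e = e}"

definition fixed :: "'a set \<Rightarrow> 'e set" where
  "fixed S = {e \<in> E. \<forall>s \<in> S. act s e = e}"

definition transitive_on :: "'a set \<Rightarrow> bool" where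
  "transitive_on A \<longleftrightarrow> (\<forall>x \<in> E. \<forall>y \<in> E. \<exists>a \<in> A. act a x = y)"

lemma act_inv_eq_iff:
  assumes "g \<in> carrier G" "e \<in> E" "f \<in> E"
  shows "act (inv g) e = f \<longleftrightarrow> act g f = e"
  using assms by (metis act_mult act_one inv_closed l_inv r_inv)

lemma act_cancel:
  assumes "g \<in> carrier G" "e \<in> E" "f \<in> E"
  shows "act g e = act g f \<longleftrightarrow> e = f"
  using assms by (metis act_closed act_inv_eq_iff)

lemma act_conj:
  assumes "g \<in> carrier G" "h \<in> carrier G" "e \<in> E"
  shows "act (g \<otimes> h \<otimes> inv g) (act g e) = act g (act h e)"
proof -
  have "act (g \<otimes> h \<otimes> inv g) (act g e) = act (g \<otimes> h \<otimes> inv g \<otimes> g) e"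
    using assms by (simp add: act_mult)
  also have "g \<otimes> h \<otimes> inv g \<otimes> g = g \<otimes> h" using assms by (simp add: m_assoc)
  finally show ?thesis using assms by (simp add: act_mult)
qed

lemma restrict_subgroup:
  assumes "subgroup K G"
  shows "finite_action (G\<lparr>carrier := K\<rparr>) E act"
proof -
  interpret K: group "G\<lparr>carrier := K\<rparr>" by (rule subgroup_imp_group[OF assms])
  show ?thesis
    using subgroup.subset[OF assms] finite_carrier finite_space
    by unfold_locales (auto intro: finite_subset act_closed act_one act_mult)
qed

lemma restrict_space:
  assumes "F \<subseteq> E" "\<And>g e. \<lbrakk>g \<in> carrier G; e \<in> F\<rbrakk> \<Longrightarrow> act g e \<in> F"
  shows "finite_action G F act"
  using assms finite_carrier finite_space
  by unfold_locales (auto intro: finite_subset act_one act_mult)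

lemma pointwise_stabilizer_subgroup:
  assumes "subgroup S G" "F \<subseteq> E"
  shows "subgroup {s \<in> S. \<forall>e \<in> F. act s e = e} G"
proof -
  interpret S: subgroup S G by fact
  have E: "e \<in> E" if "e \<in> F" for e using that assms(2) by blast
  have "\<one> \<in> {s \<in> S. \<forall>e \<in> F. act s e = e}" by (simp add: act_one E)
  then show ?thesis
    using S.subset by (intro subgroup.intro) (auto simp: act_mult act_inv_eq_iff E S.mem_carrier)
qed

lemma stabilizer_subgroup:
  assumes "subgroup S G" "x \<in> E"
  shows "subgroup {s \<in> S. act s x = x} G"
  using pointwise_stabilizer_subgroup[of S "{x}"] assms by simp

lemma kernel_on_normal:
  assumes "F \<subseteq> E" "\<And>g e. \<lbrakk>g \<in> carrier G; e \<in> F\<rbrakk> \<Longrightarrow> act g e \<in> F"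
  shows "kernel_on F \<lhd> G"
  unfolding normal_inv_iff
proof (intro conjI ballI)
  show "subgroup (kernel_on F) G"
    unfolding kernel_on_def by (rule pointwise_stabilizer_subgroup[OF subgroup_self assms(1)])
  fix g h assume g: "g \<in> carrier G" and h: "h \<in> kernel_on F"
  then have hc: "h \<in> carrier G" by (simp add: kernel_on_def)
  have "act (g \<otimes> h \<otimes> inv g) e = e" if "e \<in> F" for e
  proof -
    have e: "e \<in> E" "act (inv g) e \<in> F" using that assms g by auto
    have "act (g \<otimes> h \<otimes> inv g) e = act g (act h (act (inv g) e))"
      using e(1) g hc by (simp add: act_mult act_closed)
    also have "\<dots> = act g (act (inv g) e)" using h e(2) by (simp add: kernel_on_def)
    also have "\<dots> = e" using e(1) g by (metis act_inv_eq_iff act_closed inv_closed)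
    finally show ?thesis .
  qed
  then show "g \<otimes> h \<otimes> inv g \<in> kernel_on F" using g hc by (simp add: kernel_on_def)
qed

text \<open>Left translation by \<open>g\<close> maps the stabilizer of \<open>x\<close> bijectively
  onto the elements of \<open>S\<close> that send \<open>x\<close> to \<open>act g x\<close>, so all
  fibres of the orbit map have equal size.\<close>

lemma orbit_stabilizer:
  assumes "subgroup S G" "x \<in> E"
  shows "card S = card ((\<lambda>s. act s x) ` S) * card {s \<in> S. act s x = x}"
proof -
  interpret S: subgroup S G by fact
  have fin: "finite S" using S.subset finite_carrier by (rule finite_subset)
  have fibre: "card {s \<in> S. act s x = act g x} = card {s \<in> S. act s x = x}" if g: "g \<in> S" for g
  proof -
    have "bij_betw (\<lambda>s. g \<otimes> s) {s \<in> S. act s x = x} {s \<in> S. act s x = act g x}"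
    proof (rule bij_betw_byWitness[where f' = "\<lambda>s. inv g \<otimes> s"])
      show "\<forall>s \<in> {s \<in> S. act s x = x}. inv g \<otimes> (g \<otimes> s) = s"
        "\<forall>s \<in> {s \<in> S. act s x = act g x}. g \<otimes> (inv g \<otimes> s) = s"
        using g by (auto simp: m_assoc[symmetric] S.mem_carrier)
      show "(\<lambda>s. g \<otimes> s) ` {s \<in> S. act s x = x} \<subseteq> {s \<in> S. act s x = act g x}"
        using g assms(2) by (auto simp: act_mult S.mem_carrier)
      show "(\<lambda>s. inv g \<otimes> s) ` {s \<in> S. act s x = act g x} \<subseteq> {s \<in> S. act s x = x}"
        using g assms(2) by (auto simp: act_mult act_inv_eq_iff act_closed S.mem_carrier)
    qed
    then show ?thesis by (simp add: bij_betw_same_card)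
  qed
  have "card S = (\<Sum>z \<in> (\<lambda>s. act s x) ` S. card {s \<in> S. act s x = z})"
    using sum.image_gen[OF fin, of "\<lambda>_. 1::nat" "\<lambda>s. act s x"] by simp
  also have "\<dots> = (\<Sum>z \<in> (\<lambda>s. act s x) ` S. card {s \<in> S. act s x = x})"
    by (intro sum.cong) (auto simp: fibre)
  finally show ?thesis by simp
qed

lemma card_transitive:
  assumes "subgroup S G" "transitive_on S" "x \<in> E"
  shows "card S = card E * card {s \<in> S. act s x = x}"
proof -
  have "(\<lambda>s. act s x) ` S = E"
    using assms subgroup.mem_carrier[OF assms(1)]
    by (auto simp: transitive_on_def act_closed image_iff) metis
  then show ?thesis using orbit_stabilizer[OF assms(1,3)] by simp
qed

subsection \<open>Block systems of normal subgroups\<close>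

text \<open>Blocks are encoded by chosen representatives, so that the block action stays within the type of
  the points, as the induction on the degree requires.\<close>

definition orbit_rep :: "'a set \<Rightarrow> 'e \<Rightarrow> 'e" where
  "orbit_rep A e = (SOME y. y \<in> (\<lambda>a. act a e) ` A)"

lemma orbit_rep_in_orbit:
  assumes "subgroup A G"
  obtains a where "a \<in> A" "orbit_rep A e = act a e"
proof -
  have "act \<one> e \<in> (\<lambda>a. act a e) ` A" using subgroup.one_closed[OF assms] by blast
  then have "orbit_rep A e \<in> (\<lambda>a. act a e) ` A" unfolding orbit_rep_def by (rule someI)
  then show ?thesis using that by blast
qed

lemma orbit_rep_closed: "\<lbrakk>subgroup A G; e \<in> E\<rbrakk> \<Longrightarrow> orbit_rep A e \<in> E"
  by (rule orbit_rep_in_orbit[of A e]) (auto intro: act_closed subgroup.mem_carrier)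

text \<open>The chosen point depends only on the orbit as a set, and \<open>e\<close> and
  \<open>act a e\<close> have the same orbit under \<open>A\<close>.\<close>

lemma orbit_rep_act:
  assumes "subgroup A G" "a \<in> A" "e \<in> E"
  shows "orbit_rep A (act a e) = orbit_rep A e"
proof -
  interpret A: subgroup A G by fact
  have "act b (act a e) \<in> (\<lambda>a. act a e) ` A" if "b \<in> A" for b
    using that assms by (intro image_eqI[of _ _ "b \<otimes> a"]) (auto simp: act_mult A.mem_carrier)
  moreover have "act b e \<in> (\<lambda>b. act b (act a e)) ` A" if "b \<in> A" for b
  proof (rule image_eqI[of _ _ "b \<otimes> inv a"])
    show "act b e = act (b \<otimes> inv a) (act a e)"
      using that assms by (simp add: act_mult[symmetric] A.mem_carrier m_assoc)
    show "b \<otimes> inv a \<in> A" using that assms by simp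
  qed
  ultimately have "(\<lambda>b. act b (act a e)) ` A = (\<lambda>a. act a e) ` A" by blast
  then show ?thesis by (simp add: orbit_rep_def)
qed

lemma orbit_rep_eqD:
  assumes "subgroup A G" "e \<in> E" "f \<in> E" "orbit_rep A e = orbit_rep A f"
  obtains a where "a \<in> A" "f = act a e"
proof -
  interpret A: subgroup A G by fact
  obtain a where a: "a \<in> A" "orbit_rep A e = act a e" by (rule orbit_rep_in_orbit[OF assms(1)])
  obtain b where b: "b \<in> A" "orbit_rep A f = act b f" by (rule orbit_rep_in_orbit[OF assms(1)])
  have "act (inv b \<otimes> a) e = f"
    using a b assms by (simp add: act_mult act_inv_eq_iff act_closed A.mem_carrier)
  then show ?thesis using a b by (intro that[of "inv b \<otimes> a"]) auto
qed

lemma orbit_rep_idem: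
  assumes "subgroup A G" "e \<in> E"
  shows "orbit_rep A (orbit_rep A e) = orbit_rep A e"
  by (rule orbit_rep_in_orbit[OF assms(1), of e]) (simp add: orbit_rep_act assms)

text \<open>Since \<open>g a e = (g a g^-1) (g e)\<close>, normality makes \<open>g\<close> carry
  orbits of \<open>A\<close> to orbits of \<open>A\<close>. This makes the action on representatives
  multiplicative.\<close>

lemma orbit_rep_act_orbit_rep:
  assumes "A \<lhd> G" "g \<in> carrier G" "e \<in> E"
  shows "orbit_rep A (act g (orbit_rep A e)) = orbit_rep A (act g e)"
proof -
  interpret A: normal A G by fact
  obtain a where a: "a \<in> A" "orbit_rep A e = act a e"
    by (rule orbit_rep_in_orbit[OF A.subgroup_axioms])
  have "act g (act a e) = act (g \<otimes> a \<otimes> inv g) (act g e)"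
    using assms a by (simp add: act_conj A.mem_carrier)
  moreover have "g \<otimes> a \<otimes> inv g \<in> A" using assms a by (simp add: A.inv_op_closed2)
  ultimately show ?thesis
    using a assms by (simp add: orbit_rep_act[OF A.subgroup_axioms] act_closed)
qed

lemma block_action:
  assumes "A \<lhd> G"
  shows "finite_action G (orbit_rep A ` E) (\<lambda>g e. orbit_rep A (act g e))"
proof -
  interpret A: normal A G by fact
  note sub = A.subgroup_axioms
  have E: "e \<in> E" if "e \<in> orbit_rep A ` E" for e
    using that orbit_rep_closed[OF sub] by blast
  have one: "orbit_rep A (act \<one> e) = e" if "e \<in> orbit_rep A ` E" for e
    using that orbit_rep_closed[OF sub] by (auto simp: act_one orbit_rep_idem[OF sub])
  show ?thesis
    by unfold_locales (simp_all add: finite_carrier finite_space one E act_closed act_mult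
        orbit_rep_act_orbit_rep[OF assms])
qed

subsection \<open>Groups with a transitive subgroup that acts abelianly\<close>

text \<open>Through \<open>a \<mapsto> act a x\<close> the points correspond to the permutations
  induced by \<open>A\<close>, on which \<open>S\<close> acts by conjugation; fixed points
  correspond to permutations commuting with \<open>S\<close>. With \<open>y = act b x\<close>, the
  stabilizer of \<open>y\<close> fixes both \<open>fixed S\<close> and its translate by
  \<open>b\<close>, and these are disjoint because \<open>S\<close> moves \<open>y\<close>.\<close>

lemma card_fixed_stabilizer_double:
  assumes A: "A \<lhd> G" "transitive_on A"
    and comm: "\<And>a b e. \<lbrakk>a \<in> A; b \<in> A; e \<in> E\<rbrakk> \<Longrightarrow> act a (act b e) = act b (act a e)"
    and S: "subgroup S G" and x: "x \<in> fixed S" and y: "y \<in> E" "y \<notin> fixed S"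
  shows "2 * card (fixed S) \<le> card (fixed {s \<in> S. act s y = y})"
proof -
  interpret A: normal A G by fact
  interpret S: subgroup S G by fact
  have xE: "x \<in> E" and xfix: "\<And>s. s \<in> S \<Longrightarrow> act s x = x" using x by (auto simp: fixed_def)
  \<comment> \<open>A transitive abelian action is regular: write \<open>e = c x\<close> with
    \<open>c\<close> in \<open>A\<close> and commute \<open>c\<close> past \<open>a\<close> and
    \<open>b\<close>.\<close>
  have agree: "act a e = act b e" if "a \<in> A" "b \<in> A" "act a x = act b x" "e \<in> E" for a b e
    using that A(2) comm xE unfolding transitive_on_def by metis
  \<comment> \<open>The conjugate of \<open>a\<close> by \<open>s\<close> lies in \<open>A\<close>
    and agrees with \<open>a\<close> at \<open>x\<close>, since \<open>s\<close> fixes both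
    \<open>x\<close> and \<open>act a x\<close>; by \<open>agree\<close> it then acts as
    \<open>a\<close> everywhere.\<close>
  have central: "act s (act a e) = act a (act s e)"
    if "a \<in> A" "act a x \<in> fixed S" "s \<in> S" "e \<in> E" for a s e
  proof -
    have sc: "s \<in> carrier G" "s \<otimes> a \<otimes> inv s \<in> A"
      using that A.inv_op_closed2 S.mem_carrier by auto
    have "act (s \<otimes> a \<otimes> inv s) (act s x) = act s (act a x)"
      using that sc xE by (simp add: act_conj A.mem_carrier)
    then have "act (s \<otimes> a \<otimes> inv s) x = act a x"
      using that xfix by (simp add: fixed_def)
    then have "act (s \<otimes> a \<otimes> inv s) (act s e) = act a (act s e)"
      using that sc agree[of "s \<otimes> a \<otimes> inv s" a "act s e"] by (simp add: act_closed)
    then show ?thesis using that sc by (simp add: act_conj A.mem_carrier)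
  qed
  obtain b where b: "b \<in> A" "act b x = y" using A(2) xE y unfolding transitive_on_def by blast
  let ?S = "{s \<in> S. act s y = y}"
  have FE: "fixed S \<subseteq> E" by (auto simp: fixed_def)
  have param: "\<exists>a \<in> A. act a x = f" if "f \<in> E" for f
    using A(2) xE that unfolding transitive_on_def by blast
  have sub: "act b f \<in> fixed ?S" if f: "f \<in> fixed S" for f
  proof -
    obtain a where a: "a \<in> A" "act a x = f" using param f FE by blast
    have ba: "act b f = act a y" using a b comm xE by metis
    have "act s (act a y) = act a y" if "s \<in> ?S" for s
      using that central[of a s y] a f y by simp
    then show ?thesis using ba a y by (simp add: fixed_def act_closed A.mem_carrier)
  qed
  have disj: "act b f \<notin> fixed S" if f: "f \<in> fixed S" for f
  proof
    assume bf: "act b f \<in> fixed S"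
    obtain a where a: "a \<in> A" "act a x = f" using param f FE by blast
    have ay: "act a y = act b f" using a b comm xE by metis
    have "act s y = y" if s: "s \<in> S" for s
    proof -
      have "act a (act s y) = act s (act a y)" using central[of a s y] a f s y by simp
      also have "\<dots> = act a y" using ay bf s by (simp add: fixed_def)
      finally show ?thesis
        using a y s by (simp add: act_cancel act_closed A.mem_carrier S.mem_carrier)
    qed
    then show False using y by (simp add: fixed_def)
  qed
  have fin: "finite (fixed T)" for T using finite_space by (simp add: fixed_def)
  have "inj_on (act b) (fixed S)"
    using b FE by (auto simp: inj_on_def act_cancel A.mem_carrier subset_iff)
  then have "2 * card (fixed S) = card (fixed S \<union> act b ` fixed S)"
    using disj fin by (subst card_Un_disjoint) (auto simp: card_image)
  also have "\<dots> \<le> card (fixed ?S)"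
    using sub by (intro card_mono[OF fin]) (auto simp: fixed_def)
  finally show ?thesis .
qed

text \<open>Points are stabilized one at a time. The orbit of a moved point avoids
  \<open>fixed S\<close>, so it has length at most \<open>card E - 2 ^ i\<close>, and passing to its
  stabilizer replaces \<open>i\<close> by \<open>Suc i\<close>. When nothing is moved,
  \<open>S\<close> lies in the kernel.\<close>

lemma card_le_of_fixed:
  assumes A: "A \<lhd> G" "transitive_on A"
    and comm: "\<And>a b e. \<lbrakk>a \<in> A; b \<in> A; e \<in> E\<rbrakk> \<Longrightarrow> act a (act b e) = act b (act a e)"
    and d: "2 ^ d \<le> card E" "card E < 2 ^ Suc d"
    and S: "subgroup S G" and x: "x \<in> fixed S" and i: "2 ^ i \<le> card (fixed S)"
  shows "card S \<le> (\<Prod>j = i..<d. card E - 2 ^ j) * card (kernel_on E)"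
  using S x i
proof (induction "card E - card (fixed S)" arbitrary: S i rule: less_induct)
  case less
  interpret S: subgroup S G by fact
  \<comment> \<open>All points may be fixed before \<open>i\<close> reaches \<open>d\<close>; the
    remaining factors must then not lower the bound.\<close>
  have pos: "1 \<le> (\<Prod>j = k..<d. card E - 2 ^ j)" for k
  proof -
    have "0 < card E - 2 ^ j" if "j < d" for j
      using less_le_trans[OF power_strict_increasing[OF that, of "2::nat"] d(1)] by simp
    then show ?thesis unfolding One_nat_def Suc_le_eq by (intro prod_pos) auto
  qed
  have finE: "finite (fixed T)" "card (fixed T) \<le> card E" for T
    using finite_space by (auto simp: fixed_def intro: card_mono)
  show ?case
  proof (cases "fixed S = E")
    case True
    then have "S \<subseteq> kernel_on E" by (auto simp: fixed_def kernel_on_def S.mem_carrier)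
    then have "card S \<le> card (kernel_on E)"
      using finite_carrier by (intro card_mono) (auto simp: kernel_on_def)
    then show ?thesis using mult_le_mono[OF pos[of i]] by (metis mult_1)
  next
    case False
    then obtain y where y: "y \<in> E" "y \<notin> fixed S" by (auto simp: fixed_def)
    let ?S = "{s \<in> S. act s y = y}"
    have sub: "subgroup ?S G" by (rule stabilizer_subgroup[OF less.prems(1) y(1)])
    have double: "2 * card (fixed S) \<le> card (fixed ?S)"
      by (rule card_fixed_stabilizer_double[OF A comm less.prems(1,2) y])
    have "card (fixed S) > 0"
      using less.prems(2) finE by (auto simp: card_gt_0_iff)
    then have lt: "card E - card (fixed ?S) < card E - card (fixed S)"
      using double finE(2)[of ?S] by linarith
    have i': "2 ^ Suc i \<le> card (fixed ?S)" using double less.prems(3) by simp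
    \<comment> \<open>There are at most \<open>card E\<close> fixed points, so doubling stops before
      \<open>2 ^ Suc d\<close>; hence the factor with index \<open>i\<close> really occurs in the
      product.\<close>
    have "2 ^ Suc i < (2::nat) ^ Suc d" using i' finE(2)[of ?S] d(2) by linarith
    then have id: "i < d" by simp
    have orb: "card ((\<lambda>s. act s y) ` S) \<le> card E - 2 ^ i"
    proof -
      have "(\<lambda>s. act s y) ` S \<subseteq> E - fixed S"
      proof clarify
        fix s assume s: "s \<in> S"
        have "act s y \<notin> fixed S"
        proof
          assume *: "act s y \<in> fixed S"
          then have "act (inv s) (act s y) = act s y" using s by (simp add: fixed_def)
          then have "y = act s y"
            using s y(1) by (metis S.mem_carrier act_cancel act_closed act_inv_eq_iff)
          then show False using * y by simp
        qed
        then show "act s y \<in> E - fixed S" using s y by (simp add: act_closed S.mem_carrier)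
      qed
      then have "card ((\<lambda>s. act s y) ` S) \<le> card (E - fixed S)"
        using finite_space by (intro card_mono) auto
      also have "\<dots> = card E - card (fixed S)"
        using finE by (intro card_Diff_subset) (auto simp: fixed_def)
      finally show ?thesis using less.prems(3) by linarith
    qed
    have "card S = card ((\<lambda>s. act s y) ` S) * card ?S"
      by (rule orbit_stabilizer[OF less.prems(1) y(1)])
    also have "\<dots> \<le> (card E - 2 ^ i) * ((\<Prod>j = Suc i..<d. card E - 2 ^ j) * card (kernel_on E))"
      using less.prems(2) by (intro mult_le_mono orb less.hyps lt sub i') (auto simp: fixed_def)
    also have "\<dots> = (\<Prod>j = i..<d. card E - 2 ^ j) * card (kernel_on E)"
      using id by (simp add: prod.atLeast_Suc_lessThan)
    finally show ?thesis .
  qed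
qed

text \<open>Transitivity contributes the factor \<open>card E\<close>; the point stabilizer has at
  least \<open>2 ^ 0\<close> fixed points, so the preceding bound starts at
  \<open>i = 0\<close>.\<close>

lemma card_le_of_abelian_transitive:
  assumes A: "A \<lhd> G" "transitive_on A"
    and comm: "\<And>a b e. \<lbrakk>a \<in> A; b \<in> A; e \<in> E\<rbrakk> \<Longrightarrow> act a (act b e) = act b (act a e)"
    and d: "2 ^ d \<le> card E" "card E < 2 ^ Suc d"
  shows "card (carrier G) \<le> card E * (\<Prod>j<d. card E - 2 ^ j) * card (kernel_on E)"
proof -
  have "card E \<noteq> 0" using d(1) by (metis le_zero_eq power_eq_0_iff zero_neq_numeral)
  then obtain x where x: "x \<in> E" by fastforce
  let ?S = "{s \<in> carrier G. act s x = x}"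
  have sub: "subgroup ?S G" by (rule stabilizer_subgroup[OF subgroup_self x])
  have xf: "x \<in> fixed ?S" using x by (simp add: fixed_def)
  moreover have "finite (fixed ?S)" using finite_space by (simp add: fixed_def)
  ultimately have "2 ^ 0 \<le> card (fixed ?S)" by (simp add: Suc_le_eq card_gt_0_iff) blast
  from card_le_of_fixed[OF A comm d sub xf this]
  have "card ?S \<le> (\<Prod>j = 0..<d. card E - 2 ^ j) * card (kernel_on E)" by simp
  moreover have "transitive_on (carrier G)"
    using A(2) normal_imp_subgroup[OF A(1)]
    unfolding transitive_on_def by (meson subgroup.mem_carrier)
  ultimately show ?thesis
    using card_transitive[OF subgroup_self _ x] by (simp add: atLeast0LessThan mult.assoc)
qed

end

section \<open>Induction on the degree\<close>

text \<open>The second isomorphism theorem identifies \<open>NK/N\<close> with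
  \<open>K/(N \<inter> K)\<close>; Lagrange's theorem turns this into cardinalities.\<close>

lemma (in group) card_set_mult_normal:
  assumes N: "N \<lhd> G" and K: "subgroup K G"
  shows "card (N <#> K) * card (N \<inter> K) = card N * card K"
proof -
  interpret second_isomorphism_grp N G K
    using assms by (simp add: second_isomorphism_grp_def second_isomorphism_grp_axioms_def)
  interpret K: group "G\<lparr>carrier := K\<rparr>" by (rule subgroup_imp_group[OF K])
  interpret NK: group "G\<lparr>carrier := N <#> K\<rparr>"
    by (rule subgroup_imp_group[OF normal_set_mult_subgroup])
  have "subgroup (N \<inter> K) (G\<lparr>carrier := K\<rparr>)"
    using normal_subgrp_intersection_normal by (simp add: Int_commute normal_imp_subgroup)
  then have 1: "card (carrier (G\<lparr>carrier := K\<rparr> Mod (N \<inter> K))) * card (N \<inter> K) = card K"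
    using K.lagrange by (simp add: carrier_FactGroup FactGroup_def order_def)
  have "subgroup N (G\<lparr>carrier := N <#> K\<rparr>)"
    by (simp add: H_contained_in_set_mult normal_set_mult_subgroup subgroup_axioms subgroup_incl)
  then have 2: "card (carrier (G\<lparr>carrier := N <#> K\<rparr> Mod N)) * card N = card (N <#> K)"
    using NK.lagrange by (simp add: FactGroup_def order_def)
  have "card (carrier (G\<lparr>carrier := K\<rparr> Mod (N \<inter> K)))
      = card (carrier (G\<lparr>carrier := N <#> K\<rparr> Mod N))"
    by (rule iso_same_card) (metis is_isoI normal_intersection_quotient_isom)
  then show ?thesis by (simp only: 1[symmetric] 2[symmetric] mult_ac)
qed

lemma (in group)
  assumes N: "N \<lhd> G" and K: "subgroup K G"
  shows normal_subset_set_mult: "N \<subseteq> N <#> K" and subgroup_subset_set_mult: "K \<subseteq> N <#> K"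
proof -
  interpret second_isomorphism_grp N G K
    using assms by (simp add: second_isomorphism_grp_def second_isomorphism_grp_axioms_def)
  show "N \<subseteq> N <#> K" "K \<subseteq> N <#> K"
    by (rule H_contained_in_set_mult S_contained_in_set_mult)+
qed

text \<open>In terms of indices, \<open>b\<close> bounds \<open>|G : NK|\<close> and
  \<open>c\<close> bounds \<open>|NK : N| = |K : N \<inter> K|\<close>, so their product bounds
  \<open>|G : N|\<close>.\<close>

lemma (in group) card_le_mult_kernel:
  fixes b c :: real
  assumes fin: "finite (carrier G)" and N: "N \<lhd> G" and K: "subgroup K G" and "0 \<le> b"
    and G: "card (carrier G) \<le> b * card (N <#> K)"
    and KN: "card K \<le> c * card (N \<inter> K)"
  shows "card (carrier G) \<le> b * c * card N"
proof -
  have "\<one> \<in> N \<inter> K"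
    using N K by (simp add: subgroup.one_closed normal_imp_subgroup)
  moreover have "finite (N \<inter> K)"
    using fin subgroup.subset[OF K] by (meson finite_subset inf_le2)
  ultimately have pos: "0 < real (card (N \<inter> K))" by (auto simp: card_gt_0_iff)
  have "real (card (N <#> K)) * card (N \<inter> K) = card N * real (card K)"
    using card_set_mult_normal[OF N K] by (metis of_nat_mult)
  also have "\<dots> \<le> card N * (c * card (N \<inter> K))" by (intro mult_left_mono KN) simp
  finally have "real (card (N <#> K)) * card (N \<inter> K) \<le> (c * card N) * card (N \<inter> K)"
    by (simp add: mult_ac)
  then have "real (card (N <#> K)) \<le> c * card N" using pos by (rule mult_right_le_imp_le)
  then have "b * card (N <#> K) \<le> b * (c * card N)" using \<open>0 \<le> b\<close> by (rule mult_left_mono)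
  then show ?thesis using G by (simp add: mult.assoc)
qed

text \<open>
  \<open>P G N\<close> expresses that \<open>G/N\<close> lies in the class of groups under consideration. The bound is stated relative
  to an arbitrary \<open>G\<close>-invariant labelling \<open>r\<close> of the points, because kernels of block actions preserve
  every block and the induction needs the exponent \<open>card E\<close> minus the number of blocks for them.
\<close>

context
  fixes P :: "'g monoid \<Rightarrow> 'g set \<Rightarrow> bool" and c :: real
  assumes c: "1 \<le> c"
    and mono: "\<And>G M N. \<lbrakk>P G N; N \<subseteq> M\<rbrakk> \<Longrightarrow> P G M"
    and restrict: "\<And>G K N. \<lbrakk>group G; subgroup K G; P G N\<rbrakk> \<Longrightarrow> P (G\<lparr>carrier := K\<rparr>) (N \<inter> K)"
    and base: "\<And>G (E :: 'e set) act.
      \<lbrakk>finite_action G E act; 2 \<le> card E; P G (finite_action.kernel_on G act E);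
       finite_action.transitive_on E act (carrier G);
       \<And>A. \<lbrakk>A \<lhd> G; \<not> A \<subseteq> finite_action.kernel_on G act E\<rbrakk>
         \<Longrightarrow> finite_action.transitive_on E act A\<rbrakk>
      \<Longrightarrow> card (carrier G) \<le> c ^ (card E - 1) * card (finite_action.kernel_on G act E)"
begin

lemma card_le_power:
  fixes E :: "'e set" and r :: "'e \<Rightarrow> 'e"
  assumes "finite_action G E act" "N \<lhd> G" "P G N" "finite_action.kernel_on G act E \<subseteq> N"
    and "\<And>g e. \<lbrakk>g \<in> carrier G; e \<in> E\<rbrakk> \<Longrightarrow> r (act g e) = r e"
  shows "card (carrier G) \<le> c ^ (card E - card (r ` E)) * card N"
  using assms
proof (induction "card E" arbitrary: G E act N r rule: less_induct)
  case less
  \<comment> \<open>With at least two labels, one label class \<open>?F\<close> and its complement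
    \<open>?F'\<close> are both smaller than \<open>E\<close>, so the induction hypothesis applies
    to \<open>H\<close> on \<open>?F\<close> and to the kernel \<open>K\<close> of that action on
    \<open>?F'\<close>. Group and labelling are general because the point stabilizer and the kernel
    of the block action act on all of \<open>E\<close> and need this case too.\<close>
  have split: "card (carrier H) \<le> c ^ (card E - card (r ` E)) * card N"
    if act: "finite_action H E act" and N: "N \<lhd> H" and PN: "P H N"
      and ker: "finite_action.kernel_on H act E \<subseteq> N"
      and inv: "\<And>g e. \<lbrakk>g \<in> carrier H; e \<in> E\<rbrakk> \<Longrightarrow> r (act g e) = r e"
      and two: "2 \<le> card (r ` E)"
    for H N and r :: "'e \<Rightarrow> 'e"
  proof -
    interpret H: finite_action H E act by (rule act)
    interpret N: normal N H by (rule N)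
    obtain v where v: "v \<in> r ` E" using two by fastforce
    let ?F = "{e \<in> E. r e = v}" and ?F' = "{e \<in> E. r e \<noteq> v}"
    define K where "K = H.kernel_on ?F"
    have F: "finite_action H ?F act"
      by (rule H.restrict_space) (auto simp: inv H.act_closed)
    have K: "K \<lhd> H" unfolding K_def
      by (rule H.kernel_on_normal) (auto simp: inv H.act_closed)
    then have Ks: "subgroup K H" by (rule normal_imp_subgroup)
    interpret K: finite_action "H\<lparr>carrier := K\<rparr>" E act by (rule H.restrict_subgroup[OF Ks])
    have Kc: "k \<in> carrier H" if "k \<in> K" for k using that by (rule subgroup.mem_carrier[OF Ks])
    have F': "finite_action (H\<lparr>carrier := K\<rparr>) ?F' act"
      by (rule K.restrict_space) (auto simp: inv H.act_closed Kc)
    interpret F: finite_action H ?F act by (rule F)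
    interpret F': finite_action "H\<lparr>carrier := K\<rparr>" ?F' act by (rule F')
    have E: "E = ?F \<union> ?F'" "?F \<inter> ?F' = {}" by auto
    have cardE: "card E = card ?F + card ?F'"
      using E H.finite_space by (metis (lifting) card_Un_disjoint finite_Un)
    have rF: "r ` ?F = {v}" using v by auto
    then have F1: "1 \<le> card ?F" using F.finite_space by (auto simp: Suc_le_eq card_gt_0_iff)
    have rF': "r ` ?F' = r ` E - {v}" by auto
    then have card_rF': "card (r ` ?F') = card (r ` E) - 1"
      using v H.finite_space by simp
    have le: "card (r ` ?F') \<le> card ?F'" by (rule card_image_le[OF F'.finite_space])
    have F'1: "1 \<le> card ?F'" using le card_rF' two by linarith
    have sub: "N \<subseteq> N <#>\<^bsub>H\<^esub> K" "K \<subseteq> N <#>\<^bsub>H\<^esub> K"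
      by (rule H.normal_subset_set_mult[OF N Ks] H.subgroup_subset_set_mult[OF N Ks])+
    have "card (carrier H) \<le> c ^ (card ?F - card (r ` ?F)) * card (N <#>\<^bsub>H\<^esub> K)"
    proof (rule less.hyps[OF _ F])
      show "card ?F < card E" using cardE F'1 by linarith
      show "N <#>\<^bsub>H\<^esub> K \<lhd> H" by (rule H.normal_subgroup_set_mult_closed[OF N K])
      show "P H (N <#>\<^bsub>H\<^esub> K)" using PN sub(1) by (rule mono)
      show "F.kernel_on ?F \<subseteq> N <#>\<^bsub>H\<^esub> K" using sub(2) by (simp add: K_def)
      show "r (act g e) = r e" if "g \<in> carrier H" "e \<in> ?F" for g e using that inv by simp
    qed
    moreover have "card (carrier (H\<lparr>carrier := K\<rparr>))
        \<le> c ^ (card ?F' - card (r ` ?F')) * card (N \<inter> K)"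
    proof (rule less.hyps[OF _ F'])
      show "card ?F' < card E" using cardE F1 by linarith
      show "N \<inter> K \<lhd> H\<lparr>carrier := K\<rparr>"
        using H.normal_Int_subgroup[OF Ks N] by (simp add: Int_commute)
      show "P (H\<lparr>carrier := K\<rparr>) (N \<inter> K)" by (rule restrict[OF H.is_group Ks PN])
      have "k \<in> H.kernel_on E" if "k \<in> F'.kernel_on ?F'" for k
      proof -
        have "k \<in> K" "\<forall>e \<in> ?F'. act k e = e" using that by (simp_all add: F'.kernel_on_def)
        then show ?thesis by (auto simp: H.kernel_on_def K_def)
      qed
      then show "F'.kernel_on ?F' \<subseteq> N \<inter> K" using ker by (auto simp: F'.kernel_on_def)
      show "r (act g e) = r e" if "g \<in> carrier (H\<lparr>carrier := K\<rparr>)" "e \<in> ?F'" for g e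
        using that inv Kc by simp
    qed
    ultimately have "card (carrier H)
        \<le> c ^ (card ?F - card (r ` ?F)) * c ^ (card ?F' - card (r ` ?F')) * card N"
      using c by (intro H.card_le_mult_kernel[OF H.finite_carrier N Ks]) auto
    \<comment> \<open>\<open>?F\<close> carries one label and \<open>?F'\<close> all the others.
      Neither part has more labels than points, so truncated subtraction is harmless.\<close>
    also have "(card ?F - card (r ` ?F)) + (card ?F' - card (r ` ?F')) = card E - card (r ` E)"
      using cardE F1 le card_rF' two rF by simp
    then have "c ^ (card ?F - card (r ` ?F)) * c ^ (card ?F' - card (r ` ?F'))
        = c ^ (card E - card (r ` E))" by (simp add: power_add[symmetric])
    finally show ?thesis .
  qed
  interpret finite_action G E act by (rule less.prems)
  interpret N: normal N G by (rule less.prems)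
  show ?case
  proof (cases "2 \<le> card (r ` E)")
    case True
    then show ?thesis using less.prems by (intro split)
  next
    case False
    \<comment> \<open>At most one label remains, so the exponent is \<open>card E - 1\<close>; for
      empty \<open>E\<close> both exponents are 0.\<close>
    have target: ?thesis if "card (carrier G) \<le> c ^ (card E - 1) * card N"
    proof (cases "E = {}")
      case True
      then show ?thesis using that by simp
    next
      case False
      then have "1 \<le> card (r ` E)" using finite_space by (simp add: Suc_le_eq card_gt_0_iff)
      then have "card (r ` E) = 1" using \<open>\<not> 2 \<le> card (r ` E)\<close> by linarith
      then show ?thesis using that by simp
    qed
    have weaken: ?thesis if "card (carrier G) \<le> c ^ k * card N" "k \<le> card E - 1" for k
    proof (rule target)
      have "c ^ k * card N \<le> c ^ (card E - 1) * card N"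
        using that(2) c by (intro mult_right_mono power_increasing) auto
      then show "card (carrier G) \<le> c ^ (card E - 1) * card N" using that(1) by linarith
    qed
    \<comment> \<open>If no intransitive normal subgroup lies outside the kernel, then each of
      \<open>G\<close> and \<open>N\<close> is transitive or lies in the kernel.\<close>
    consider (small) "card E \<le> 1"
      | (intransitive) A where "2 \<le> card E" "A \<lhd> G" "\<not> A \<subseteq> kernel_on E" "\<not> transitive_on A"
      | (trivial) "2 \<le> card E" "\<not> transitive_on (carrier G)" "carrier G \<subseteq> kernel_on E"
      | (transitive) "2 \<le> card E" "transitive_on N"
      | (primitive) "2 \<le> card E" "transitive_on (carrier G)" "N \<subseteq> kernel_on E"
          "\<And>A. \<lbrakk>A \<lhd> G; \<not> A \<subseteq> kernel_on E\<rbrakk> \<Longrightarrow> transitive_on A"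
      using less.prems(2) normal_self by (metis not_less_eq_eq numeral_2_eq_2 One_nat_def)
    then show ?thesis
    proof cases
      case small
      have "act g e = e" if "g \<in> carrier G" "e \<in> E" for g e
        using card_le_Suc0_iff_eq[OF finite_space] small that by (simp add: act_closed)
      then have "carrier G \<subseteq> N" using less.prems(4) by (auto simp: kernel_on_def)
      then have "carrier G = N" using N.subset by blast
      then show ?thesis by (intro weaken[of 0]) auto
    next
      case trivial
      then have "carrier G \<subseteq> N" using less.prems(4) by blast
      then have "carrier G = N" using N.subset by blast
      then show ?thesis by (intro weaken[of 0]) auto
    next
      case transitive
      have "card E \<noteq> 0" using transitive by linarith
      then obtain x where x: "x \<in> E" by fastforce
      have "\<exists>y \<in> E. y \<noteq> x"
      proof (rule ccontr)
        assume "\<not> ?thesis"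
        then have "E \<subseteq> {x}" by blast
        then have "card E \<le> card {x}" by (intro card_mono) auto
        then show False using transitive by simp
      qed
      then obtain y where y: "y \<in> E" "y \<noteq> x" by blast
      \<comment> \<open>The labels separate \<open>x\<close> from all other points; \<open>y\<close>
        serves only as the second label. The stabilizer preserves this labelling, so
        \<open>split\<close> gives the exponent \<open>card E - 2\<close>.\<close>
      let ?S = "{g \<in> carrier G. act g x = x}" and ?r = "\<lambda>e. if e = x then x else y"
      have S: "subgroup ?S G" by (rule stabilizer_subgroup[OF subgroup_self x])
      interpret S: finite_action "G\<lparr>carrier := ?S\<rparr>" E act by (rule restrict_subgroup[OF S])
      have "?r ` E = {x, y}" using x y by auto
      then have r2: "card (?r ` E) = 2" using y by simp
      have "card (carrier (G\<lparr>carrier := ?S\<rparr>)) \<le> c ^ (card E - card (?r ` E)) * card (N \<inter> ?S)"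
      proof (rule split)
        show "finite_action (G\<lparr>carrier := ?S\<rparr>) E act" by (rule S.finite_action_axioms)
        show "N \<inter> ?S \<lhd> G\<lparr>carrier := ?S\<rparr>"
          using normal_Int_subgroup[OF S less.prems(2)] by (simp add: Int_commute)
        show "P (G\<lparr>carrier := ?S\<rparr>) (N \<inter> ?S)" by (rule restrict[OF is_group S less.prems(3)])
        show "S.kernel_on E \<subseteq> N \<inter> ?S"
          using less.prems(4) by (auto simp: S.kernel_on_def kernel_on_def)
        show "?r (act g e) = ?r e" if "g \<in> carrier (G\<lparr>carrier := ?S\<rparr>)" "e \<in> E" for g e
        proof -
          have "act g e = x \<longleftrightarrow> e = x" using that x act_cancel[of g e x] by auto
          then show ?thesis by simp
        qed
        show "2 \<le> card (?r ` E)" using r2 by simp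
      qed
      then have le: "card ?S \<le> c ^ (card E - 2) * card (N \<inter> ?S)"
        unfolding r2 by simp
      have "transitive_on (carrier G)"
        using transitive N.subset unfolding transitive_on_def by blast
      then have "card (carrier G) = card E * card ?S"
        by (intro card_transitive subgroup_self x)
      then have "card (carrier G) \<le> card E * (c ^ (card E - 2) * card (N \<inter> ?S))"
        using le by (simp add: mult_left_mono)
      \<comment> \<open>As \<open>N\<close> is transitive too, the factor \<open>card E\<close>
        occurs in both group orders and cancels.\<close>
      moreover have "N \<inter> ?S = {s \<in> N. act s x = x}" using N.subset by auto
      then have "card N = card E * card (N \<inter> ?S)"
        using card_transitive[OF N.subgroup_axioms transitive(2) x] by simp
      ultimately have "card (carrier G) \<le> c ^ (card E - 2) * card N" by (simp add: mult_ac)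
      then show ?thesis by (rule weaken) simp
    next
      case primitive
      then have eq: "kernel_on E = N" using less.prems(4) by blast
      show ?thesis
      proof (rule target)
        show "card (carrier G) \<le> c ^ (card E - 1) * card N"
          using base[OF less.prems(1)] primitive less.prems(3) eq by simp
      qed
    next
      case (intransitive A)
      interpret A: normal A G by (rule intransitive)
      note sub = A.subgroup_axioms
      let ?r = "orbit_rep A"
      let ?E = "?r ` E"
      interpret B: finite_action G ?E "\<lambda>g e. ?r (act g e)" by (rule block_action[OF intransitive(2)])
      define K where "K = B.kernel_on ?E"
      have K: "K \<lhd> G" unfolding K_def by (intro B.kernel_on_normal subset_refl B.act_closed)
      then have Ks: "subgroup K G" by (rule normal_imp_subgroup)
      interpret K: finite_action "G\<lparr>carrier := K\<rparr>" E act by (rule restrict_subgroup[OF Ks])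
      have Kr: "?r (act k e) = ?r e" if "k \<in> K" "e \<in> E" for k e
      proof -
        have "?r (act k (?r e)) = ?r e" "k \<in> carrier G"
          using that by (auto simp: K_def B.kernel_on_def)
        then show ?thesis using orbit_rep_act_orbit_rep[OF intransitive(2) _ that(2), of k] by simp
      qed
      have two: "2 \<le> card ?E"
      proof (rule ccontr)
        assume "\<not> 2 \<le> card ?E"
        then have "card ?E \<le> Suc 0" by simp
        then have "?r e = ?r f" if "e \<in> E" "f \<in> E" for e f
          using card_le_Suc0_iff_eq[OF B.finite_space] that by blast
        then have "transitive_on A"
          unfolding transitive_on_def by (metis orbit_rep_eqD[OF sub])
        then show False using intransitive by blast
      qed
      \<comment> \<open>With as many orbits as points, every orbit would be a single point and
        \<open>A\<close> would lie in the kernel.\<close>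
      have lt: "card ?E < card E"
      proof (rule ccontr)
        assume "\<not> card ?E < card E"
        then have "card ?E = card E" using card_image_le[OF finite_space, of ?r] by linarith
        then have "inj_on ?r E" by (rule eq_card_imp_inj_on[OF finite_space])
        then have "act a e = e" if "a \<in> A" "e \<in> E" for a e
          using that orbit_rep_act[OF sub that] by (auto simp: inj_on_def act_closed A.mem_carrier)
        then show False using intransitive by (auto simp: kernel_on_def A.mem_carrier)
      qed
      have sNK: "N \<subseteq> N <#>\<^bsub>G\<^esub> K" "K \<subseteq> N <#>\<^bsub>G\<^esub> K"
        using less.prems(2) Ks by (rule normal_subset_set_mult subgroup_subset_set_mult)+
      \<comment> \<open>A constant label on the blocks yields the exponent
        \<open>card ?E - 1\<close>.\<close>
      define x where "x = (SOME x. x \<in> E)"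
      have "card (carrier G) \<le> c ^ (card ?E - card ((\<lambda>_. x) ` ?E)) * card (N <#>\<^bsub>G\<^esub> K)"
      proof (rule less.hyps[OF lt B.finite_action_axioms])
        show "N <#>\<^bsub>G\<^esub> K \<lhd> G" by (rule normal_subgroup_set_mult_closed[OF less.prems(2) K])
        show "P G (N <#>\<^bsub>G\<^esub> K)" using less.prems(3) sNK(1) by (rule mono)
        show "B.kernel_on ?E \<subseteq> N <#>\<^bsub>G\<^esub> K" using sNK(2) by (simp add: K_def)
      qed simp
      moreover have "card ((\<lambda>_. x) ` ?E) = 1"
      proof -
        have "?E \<noteq> {}" using two by fastforce
        then have "(\<lambda>_. x) ` ?E = {x}" by auto
        then show ?thesis by simp
      qed
      moreover have "card (carrier (G\<lparr>carrier := K\<rparr>)) \<le> c ^ (card E - card ?E) * card (N \<inter> K)"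
      proof (rule split[OF K.finite_action_axioms])
        show "N \<inter> K \<lhd> G\<lparr>carrier := K\<rparr>"
          using normal_Int_subgroup[OF Ks less.prems(2)] by (simp add: Int_commute)
        show "P (G\<lparr>carrier := K\<rparr>) (N \<inter> K)" by (rule restrict[OF is_group Ks less.prems(3)])
        show "K.kernel_on E \<subseteq> N \<inter> K"
          using less.prems(4) subgroup.mem_carrier[OF Ks] by (auto simp: K.kernel_on_def kernel_on_def)
      qed (use Kr two in auto)
      ultimately have "card (carrier G) \<le> c ^ (card ?E - 1) * c ^ (card E - card ?E) * card N"
        using c by (intro card_le_mult_kernel[OF finite_carrier less.prems(2) Ks]) auto
      also have "c ^ (card ?E - 1) * c ^ (card E - card ?E) = c ^ (card E - 1)"
        using lt two by (simp add: power_add[symmetric])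
      finally show ?thesis by (rule target)
    qed
  qed
qed

end

section \<open>The transitive base cases\<close>

lemma (in finite_action) commutator_in_kernel:
  assumes "g \<in> carrier G" "h \<in> carrier G" "e \<in> E"
    and "g \<otimes> h \<otimes> inv g \<otimes> inv h \<in> kernel_on E"
  shows "act g (act h e) = act h (act g e)"
proof -
  have "g \<otimes> h = (g \<otimes> h \<otimes> inv g \<otimes> inv h) \<otimes> (h \<otimes> g)"
    using assms(1,2) by (simp add: m_assoc) (simp add: m_assoc[symmetric])
  then have "act (g \<otimes> h) e = act (g \<otimes> h \<otimes> inv g \<otimes> inv h) (act (h \<otimes> g) e)"
    using assms(1-3) by (metis act_mult inv_closed m_closed)
  also have "\<dots> = act (h \<otimes> g) e" using assms by (simp add: kernel_on_def act_closed)
  finally show ?thesis using assms(1-3) by (simp add: act_mult)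
qed

text \<open>An element fixing \<open>x\<close> also fixes every \<open>act a x\<close>, hence all of
  \<open>E\<close>. So point stabilizers lie in the kernel.\<close>

lemma (in finite_action) card_le_of_central_transitive:
  assumes A: "A \<subseteq> carrier G" "transitive_on A" and "E \<noteq> {}"
    and comm: "\<And>a g e. \<lbrakk>a \<in> A; g \<in> carrier G; e \<in> E\<rbrakk> \<Longrightarrow> act a (act g e) = act g (act a e)"
  shows "card (carrier G) \<le> card E * card (kernel_on E)"
proof -
  obtain x where x: "x \<in> E" using assms(3) by blast
  let ?S = "{g \<in> carrier G. act g x = x}"
  have "act g e = e" if g: "g \<in> ?S" and e: "e \<in> E" for g e
  proof -
    obtain a where "a \<in> A" "act a x = e"
      using A(2) x e unfolding transitive_on_def by blast
    then show ?thesis using comm[of a g x] g x by simp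
  qed
  then have "?S \<subseteq> kernel_on E" by (auto simp: kernel_on_def)
  then have "card ?S \<le> card (kernel_on E)"
    using finite_carrier by (intro card_mono) (auto simp: kernel_on_def)
  moreover have "transitive_on (carrier G)"
    using A unfolding transitive_on_def by blast
  ultimately show ?thesis using card_transitive[OF subgroup_self _ x] by simp
qed

section \<open>Normality and restriction of the lower central and derived series\<close>

text \<open>The commutator of \<open>x\<close> and \<open>g\<close> lies in the next term, hence in
  this one, and \<open>g x g^-1\<close> is its inverse times \<open>x\<close>.\<close>

lemma (in group) lower_central_normal: "lower_central G k \<lhd> G"
  unfolding normal_inv_iff
proof (intro conjI ballI)
  show sub: "subgroup (lower_central G k) G" by (rule lower_central_subgroup)
  fix g x assume g: "g \<in> carrier G" and x: "x \<in> lower_central G k"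
  have xc: "x \<in> carrier G" using subgroup.mem_carrier[OF sub x] .
  have "x \<otimes> g \<otimes> inv x \<otimes> inv g \<in> lower_central G (Suc k)"
    using g x by (auto intro: generate.incl)
  then have "x \<otimes> g \<otimes> inv x \<otimes> inv g \<in> lower_central G k"
    using lower_central_antimono[of k "Suc k"] by auto
  then have "inv (x \<otimes> g \<otimes> inv x \<otimes> inv g) \<otimes> x \<in> lower_central G k"
    using x sub by (simp add: subgroup.m_closed subgroup.m_inv_closed)
  moreover have "inv (x \<otimes> g \<otimes> inv x \<otimes> inv g) \<otimes> x = g \<otimes> x \<otimes> inv g"
    using g xc by (simp add: inv_mult_group m_assoc)
  ultimately show "g \<otimes> x \<otimes> inv g \<in> lower_central G k" by simp
qed

lemma (in group) lower_central_restrict: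
  assumes "subgroup K G"
  shows "lower_central (G\<lparr>carrier := K\<rparr>) k \<subseteq> lower_central G k \<inter> K"
proof -
  interpret K: group "G\<lparr>carrier := K\<rparr>" by (rule subgroup_imp_group[OF assms])
  have inK: "lower_central (G\<lparr>carrier := K\<rparr>) k \<subseteq> K" for k
    using subgroup.subset[OF K.lower_central_subgroup] by simp
  have "lower_central (G\<lparr>carrier := K\<rparr>) k \<subseteq> lower_central G k"
  proof (induction k)
    case 0
    show ?case using subgroup.subset[OF assms] by simp
  next
    case (Suc k)
    let ?C = "\<Union>x \<in> lower_central (G\<lparr>carrier := K\<rparr>) k. \<Union>y \<in> K. {x \<otimes> y \<otimes> inv x \<otimes> inv y}"
    have "lower_central (G\<lparr>carrier := K\<rparr>) (Suc k) = generate (G\<lparr>carrier := K\<rparr>) ?C"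
      using inK[of k] assms by (simp add: m_inv_consistent subset_iff cong: SUP_cong)
    also have "\<dots> = generate G ?C"
    proof (rule generate_consistent[OF _ assms])
      show "?C \<subseteq> K"
        using inK[of k] assms by (auto simp: subgroup.m_closed subgroup.m_inv_closed subset_iff)
    qed
    also have "\<dots> \<subseteq> lower_central G (Suc k)"
      unfolding lower_central.simps
      using Suc.IH subgroup.subset[OF assms] by (intro mono_generate) blast
    finally show ?case .
  qed
  then show ?thesis using inK by blast
qed

lemma (in group) exp_of_derived_normal: "(derived G ^^ k) (carrier G) \<lhd> G"
  by (induction k) (auto intro: derived_is_normal normal_self)

lemma (in group) exp_of_derived_restrict:
  assumes "subgroup K G"
  shows "(derived (G\<lparr>carrier := K\<rparr>) ^^ k) K \<subseteq> (derived G ^^ k) (carrier G) \<inter> K"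
proof -
  interpret K: group "G\<lparr>carrier := K\<rparr>" by (rule subgroup_imp_group[OF assms])
  have inK: "(derived (G\<lparr>carrier := K\<rparr>) ^^ k) K \<subseteq> K" for k
    using K.exp_of_derived_in_carrier[of K k] by simp
  have "(derived (G\<lparr>carrier := K\<rparr>) ^^ k) K = (derived G ^^ k) K"
  proof (induction k)
    case (Suc k)
    then show ?case using derived_consistent[OF inK[of k] assms] by simp
  qed simp
  moreover have "(derived G ^^ k) K \<subseteq> (derived G ^^ k) (carrier G)"
    by (rule mono_exp_of_derived[OF subgroup.subset[OF assms]])
  ultimately show ?thesis using inK by blast
qed

lemma (in finite_action) card_le_primitive_nilpotent:
  assumes "lower_central G k \<subseteq> kernel_on E" "2 \<le> card E"
    and trans: "\<And>A. \<lbrakk>A \<lhd> G; \<not> A \<subseteq> kernel_on E\<rbrakk> \<Longrightarrow> transitive_on A"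
  shows "card (carrier G) \<le> 2 ^ (card E - 1) * card (kernel_on E)"
proof (cases "carrier G \<subseteq> kernel_on E")
  case True
  then have "card (carrier G) \<le> 1 * card (kernel_on E)"
    using finite_carrier by (simp add: card_mono kernel_on_def)
  also have "\<dots> \<le> 2 ^ (card E - 1) * card (kernel_on E)" by (intro mult_le_mono1) simp
  finally show ?thesis .
next
  case False
  then have "\<not> lower_central G 0 \<subseteq> kernel_on E" by simp
  \<comment> \<open>The last term outside the kernel: its commutators with all of \<open>G\<close>
    act trivially, so it acts centrally.\<close>
  then obtain j where j: "\<not> lower_central G j \<subseteq> kernel_on E"
      "lower_central G (Suc j) \<subseteq> kernel_on E"
    using ex_least_nat_less[of "\<lambda>k. lower_central G k \<subseteq> kernel_on E", OF assms(1)] by blast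
  let ?A = "lower_central G j"
  have A: "?A \<subseteq> carrier G" by (rule subgroup.subset[OF lower_central_subgroup])
  have "act a (act g e) = act g (act a e)" if "a \<in> ?A" "g \<in> carrier G" "e \<in> E" for a g e
  proof (rule commutator_in_kernel)
    show "a \<otimes> g \<otimes> inv a \<otimes> inv g \<in> kernel_on E"
      using that j(2) by (auto intro: generate.incl)
  qed (use that A in auto)
  moreover have "E \<noteq> {}" using assms(2) by auto
  ultimately have "card (carrier G) \<le> card E * card (kernel_on E)"
    using card_le_of_central_transitive[OF A trans[OF lower_central_normal j(1)]] by blast
  also have "card E \<le> 2 ^ (card E - 1)"
    using assms(2) less_exp[of "card E - 1"] by linarith
  finally show ?thesis by simp
qed

lemma (in finite_action) card_le_primitive_solvable:
  assumes "(derived G ^^ k) (carrier G) \<subseteq> kernel_on E" "2 \<le> card E"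
    and trans: "\<And>A. \<lbrakk>A \<lhd> G; \<not> A \<subseteq> kernel_on E\<rbrakk> \<Longrightarrow> transitive_on A"
    and d: "2 ^ d \<le> card E" "card E < 2 ^ Suc d"
  shows "card (carrier G) \<le> card E * (\<Prod>j<d. card E - 2 ^ j) * card (kernel_on E)"
proof (cases "carrier G \<subseteq> kernel_on E")
  case True
  have "0 < card E - 2 ^ j" if "j < d" for j
    using less_le_trans[OF power_strict_increasing[OF that, of "2::nat"] d(1)] by simp
  then have "0 < (\<Prod>j<d. card E - 2 ^ j)" by (intro prod_pos) auto
  then have pos: "1 \<le> card E * (\<Prod>j<d. card E - 2 ^ j)" using assms(2) by (simp add: Suc_le_eq)
  have "card (carrier G) \<le> 1 * card (kernel_on E)"
    using True finite_carrier by (simp add: card_mono kernel_on_def)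
  also have "\<dots> \<le> card E * (\<Prod>j<d. card E - 2 ^ j) * card (kernel_on E)"
    by (intro mult_le_mono1 pos)
  finally show ?thesis .
next
  case False
  then have "\<not> (derived G ^^ 0) (carrier G) \<subseteq> kernel_on E" by simp
  \<comment> \<open>The commutators within this last term outside the kernel act trivially, so it
    acts as an abelian group.\<close>
  then obtain j where j: "\<not> (derived G ^^ j) (carrier G) \<subseteq> kernel_on E"
      "(derived G ^^ Suc j) (carrier G) \<subseteq> kernel_on E"
    using ex_least_nat_less[of "\<lambda>k. (derived G ^^ k) (carrier G) \<subseteq> kernel_on E", OF assms(1)]
    by blast
  let ?A = "(derived G ^^ j) (carrier G)"
  have A: "?A \<subseteq> carrier G" by (rule exp_of_derived_in_carrier) simp
  have "act a (act b e) = act b (act a e)" if "a \<in> ?A" "b \<in> ?A" "e \<in> E" for a b e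
  proof (rule commutator_in_kernel)
    show "a \<otimes> b \<otimes> inv a \<otimes> inv b \<in> kernel_on E"
      using that j(2) by (auto simp: derived_def intro: generate.incl)
  qed (use that A in auto)
  then show ?thesis
    by (rule card_le_of_abelian_transitive[OF exp_of_derived_normal trans[OF exp_of_derived_normal j(1)] _ d])
qed

section \<open>Permutation groups as faithful actions\<close>

lemma permutation_group_action:
  assumes "finite \<Omega>" "subgroup H (BijGroup \<Omega>)"
  shows "finite_action ((BijGroup \<Omega>)\<lparr>carrier := H\<rparr>) \<Omega> (\<lambda>g. g)"
proof -
  interpret H: group "(BijGroup \<Omega>)\<lparr>carrier := H\<rparr>"
    by (rule group.subgroup_imp_group[OF group_BijGroup assms(2)])
  have H: "H \<subseteq> Bij \<Omega>" using subgroup.subset[OF assms(2)] by (simp add: BijGroup_def)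
  have "Bij \<Omega> \<subseteq> \<Omega> \<rightarrow>\<^sub>E \<Omega>"
    by (auto simp: PiE_def dest: Bij_imp_extensional Bij_imp_funcset)
  then have "finite H" using H assms(1) by (meson finite_PiE finite_subset)
  moreover have "g e \<in> \<Omega>" if "g \<in> H" "e \<in> \<Omega>" for g e
    using that H by (blast dest: Bij_imp_funcset)
  moreover have "(g \<otimes>\<^bsub>BijGroup \<Omega>\<^esub> h) e = g (h e)" if "g \<in> H" "h \<in> H" "e \<in> \<Omega>" for g h e
    using that H by (auto simp: BijGroup_def compose_def)
  moreover have "\<one>\<^bsub>BijGroup \<Omega>\<^esub> e = e" if "e \<in> \<Omega>" for e
    using that by (simp add: BijGroup_def)
  ultimately show ?thesis using assms(1) by unfold_locales simp_all
qed

text \<open>Elements of \<open>BijGroup\<close> are extensional functions, so fixing every point of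
  \<Omega> determines them completely.\<close>

lemma permutation_group_kernel:
  assumes "finite \<Omega>" "subgroup H (BijGroup \<Omega>)"
  shows "finite_action.kernel_on ((BijGroup \<Omega>)\<lparr>carrier := H\<rparr>) (\<lambda>g. g) \<Omega> \<subseteq> {\<one>\<^bsub>BijGroup \<Omega>\<^esub>}"
proof -
  interpret finite_action "(BijGroup \<Omega>)\<lparr>carrier := H\<rparr>" \<Omega> "\<lambda>g. g"
    by (rule permutation_group_action[OF assms])
  have H: "H \<subseteq> Bij \<Omega>" using subgroup.subset[OF assms(2)] by (simp add: BijGroup_def)
  have "g = (\<lambda>x \<in> \<Omega>. x)" if "g \<in> H" "\<forall>e \<in> \<Omega>. g e = e" for g
    using that H by (intro extensionalityI[of _ \<Omega>]) (auto dest: Bij_imp_extensional)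
  moreover have "\<one>\<^bsub>BijGroup \<Omega>\<^esub> = (\<lambda>x \<in> \<Omega>. x)" by (simp add: BijGroup_def)
  ultimately show ?thesis by (auto simp: kernel_on_def)
qed

section \<open>Numerical estimate of the product\<close>

text \<open>All \<open>d + 1\<close> factors are below \<open>2 ^ Suc d\<close>, so the cube is at
  most 2 to the power \<open>3 * (Suc d)^2\<close>. From \<open>d = 5\<close> on, this exponent is
  at most \<open>4 * (2 ^ d - 1)\<close>, and 16 is less than 24.\<close>

lemma prod_power_bound_large:
  fixes d n :: nat
  assumes "5 \<le> d" "2 ^ d \<le> n" "n < 2 ^ Suc d"
  shows "(n * (\<Prod>j<d. n - 2 ^ j)) ^ 3 \<le> 24 ^ (n - 1)"
proof -
  have exp: "3 * (Suc d)\<^sup>2 + 4 \<le> 4 * 2 ^ d"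
    using assms(1)
  proof (induction d rule: dec_induct)
    case (step m)
    have "1 * 1 \<le> m * m" using step.hyps by (intro mult_le_mono) auto
    moreover have "3 * (m * m) + 6 * m + 7 \<le> 4 * 2 ^ m"
      using step.IH by (simp add: power2_eq_square algebra_simps)
    ultimately have "3 * (m * m) + 12 * m + 16 \<le> 8 * 2 ^ m" by linarith
    then show ?case by (simp add: power2_eq_square algebra_simps)
  qed (simp add: power2_eq_square)
  have "(\<Prod>j<d. n - 2 ^ j) \<le> (\<Prod>j<d. n)" by (intro prod_mono) auto
  then have "n * (\<Prod>j<d. n - 2 ^ j) \<le> n ^ Suc d" by simp
  also have "\<dots> \<le> (2 ^ Suc d) ^ Suc d" using assms(3) by (intro power_mono) auto
  finally have "(n * (\<Prod>j<d. n - 2 ^ j)) ^ 3 \<le> ((2 ^ Suc d) ^ Suc d) ^ 3"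
    by (intro power_mono) auto
  also have "\<dots> = 2 ^ (3 * (Suc d)\<^sup>2)"
    by (simp only: power_mult[symmetric] power2_eq_square mult.commute)
  also have "\<dots> \<le> 2 ^ (4 * (2 ^ d - 1))" using exp by (intro power_increasing) auto
  also have "\<dots> = 16 ^ (2 ^ d - 1)" by (simp add: power_mult)
  also have "\<dots> \<le> 24 ^ (2 ^ d - 1)" by (intro power_mono) auto
  also have "\<dots> \<le> 24 ^ (n - 1)" using assms(2) by (intro power_increasing) auto
  finally show ?thesis .
qed

text \<open>The crude estimate fails for small \<open>d\<close>, so the degrees up to 31 are checked
  by evaluation. Equality holds at \<open>n = 4\<close>, where the product is
  \<open>4 * 3 * 2 = 24\<close>; this is where the constant comes from.\<close>

lemma prod_power_bound:
  fixes d n :: nat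
  assumes "2 ^ d \<le> n" "n < 2 ^ Suc d"
  shows "(n * (\<Prod>j<d. n - 2 ^ j)) ^ 3 \<le> 24 ^ (n - 1)"
proof -
  have n: "n \<in> set [2 ^ d..<2 ^ Suc d]" using assms by simp
  have sets: "{..<2} = {0, 1::nat}" "{..<3} = {0, 1, 2::nat}" "{..<4} = {0, 1, 2, 3::nat}" by auto
  consider "d = 0" | "d = 1" | "d = 2" | "d = 3" | "d = 4" | "5 \<le> d" by arith
  then show ?thesis
  proof cases
    case 1
    then have "n = 1" using assms by simp
    then show ?thesis using 1 by simp
  next
    case 6
    then show ?thesis using assms by (rule prod_power_bound_large)
  qed (use n in \<open>auto simp: sets simp del: set_upt\<close>)
qed

section \<open>Application to nilpotent and solvable quotients\<close>

text \<open>\<open>P\<close> says that some term of the series lies in \<open>N\<close>, which for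
  normal \<open>N\<close> means that the quotient is nilpotent. In this form closure under quotients
  is mere monotonicity in \<open>N\<close>.\<close>

lemma card_le_nilpotent:
  fixes G :: "'g monoid" and E :: "'e set"
  assumes "finite_action G E act" "N \<lhd> G" "lower_central G k \<subseteq> N"
    and "finite_action.kernel_on G act E \<subseteq> N" "E \<noteq> {}"
  shows "card (carrier G) \<le> 2 ^ (card E - 1) * card N"
proof -
  obtain x where "x \<in> E" using assms(5) by blast
  \<comment> \<open>A single label turns the exponent of \<open>card_le_power\<close> into
    \<open>card E - 1\<close>.\<close>
  then have img: "(\<lambda>_. x) ` E = {x}" by auto
  have "real (card (carrier G)) \<le> 2 ^ (card E - card ((\<lambda>_. x) ` E)) * real (card N)"
  proof (rule card_le_power[where P = "\<lambda>G N. \<exists>k. lower_central G k \<subseteq> N", OF _ _ _ _ assms(1,2) _ assms(4)])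
    show "\<exists>k. lower_central (G\<lparr>carrier := K\<rparr>) k \<subseteq> N \<inter> K"
      if "group G" "subgroup K G" "\<exists>k. lower_central G k \<subseteq> N" for G :: "'g monoid" and K N
      using that group.lower_central_restrict[OF that(1,2)] by blast
    fix G :: "'g monoid" and E :: "'e set" and act
    assume G: "finite_action G E act" "2 \<le> card E"
      "\<exists>k. lower_central G k \<subseteq> finite_action.kernel_on G act E"
      "\<And>A. \<lbrakk>A \<lhd> G; \<not> A \<subseteq> finite_action.kernel_on G act E\<rbrakk>
         \<Longrightarrow> finite_action.transitive_on E act A"
    then have "card (carrier G) \<le> 2 ^ (card E - 1) * card (finite_action.kernel_on G act E)"
      using finite_action.card_le_primitive_nilpotent by blast
    then have "real (card (carrier G))
        \<le> real (2 ^ (card E - 1) * card (finite_action.kernel_on G act E))"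
      by (rule of_nat_mono)
    then show "real (card (carrier G))
        \<le> 2 ^ (card E - 1) * real (card (finite_action.kernel_on G act E))" by simp
  qed (use assms(3) in auto)
  then have "real (card (carrier G)) \<le> real (2 ^ (card E - 1) * card N)" by (simp add: img)
  then show ?thesis by (simp only: of_nat_le_iff)
qed

lemma prod_power_bound_lambda:
  assumes "2 ^ d \<le> n" "n < 2 ^ Suc d"
  shows "real (n * (\<Prod>j<d. n - 2 ^ j)) \<le> lambda ^ (n - 1)"
proof (rule power_le_imp_le_base)
  have "real ((n * (\<Prod>j<d. n - 2 ^ j)) ^ 3) \<le> real (24 ^ (n - 1))"
    using prod_power_bound[OF assms] by (rule of_nat_mono)
  also have "real (24 ^ (n - 1)) = (lambda ^ 3) ^ (n - 1)" by (simp add: lambda_def)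
  also have "\<dots> = (lambda ^ (n - 1)) ^ 3" by (simp only: power_mult[symmetric] mult.commute)
  \<comment> \<open>Both sides are compared through their cubes, because
    \<open>lambda ^ 3 = 24\<close>; the exponent is written \<open>Suc 2\<close> to fit the
    cancellation rule.\<close>
  finally show "real (n * (\<Prod>j<d. n - 2 ^ j)) ^ Suc 2 \<le> (lambda ^ (n - 1)) ^ Suc 2"
    by (simp only: of_nat_power Suc_numeral semiring_norm)
  show "0 \<le> lambda ^ (n - 1)" by (simp add: lambda_def)
qed

lemma card_le_solvable:
  fixes G :: "'g monoid" and E :: "'e set"
  assumes "finite_action G E act" "N \<lhd> G" "(derived G ^^ k) (carrier G) \<subseteq> N"
    and "finite_action.kernel_on G act E \<subseteq> N" "E \<noteq> {}"
  shows "card (carrier G) \<le> lambda ^ (card E - 1) * card N"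
proof -
  obtain x where "x \<in> E" using assms(5) by blast
  then have img: "(\<lambda>_. x) ` E = {x}" by auto
  have "real (card (carrier G)) \<le> lambda ^ (card E - card ((\<lambda>_. x) ` E)) * real (card N)"
  proof (rule card_le_power[where P = "\<lambda>G N. \<exists>k. (derived G ^^ k) (carrier G) \<subseteq> N",
        OF _ _ _ _ assms(1,2) _ assms(4)])
    show "1 \<le> lambda" by (simp add: lambda_def)
    show "\<exists>k. (derived (G\<lparr>carrier := K\<rparr>) ^^ k) (carrier (G\<lparr>carrier := K\<rparr>)) \<subseteq> N \<inter> K"
      if "group G" "subgroup K G" "\<exists>k. (derived G ^^ k) (carrier G) \<subseteq> N"
      for G :: "'g monoid" and K N
      using that group.exp_of_derived_restrict[OF that(1,2)] by fastforce
    fix G :: "'g monoid" and E :: "'e set" and act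
    assume G: "finite_action G E act" "2 \<le> card E"
      "\<exists>k. (derived G ^^ k) (carrier G) \<subseteq> finite_action.kernel_on G act E"
      "\<And>A. \<lbrakk>A \<lhd> G; \<not> A \<subseteq> finite_action.kernel_on G act E\<rbrakk>
         \<Longrightarrow> finite_action.transitive_on E act A"
    \<comment> \<open>\<open>d\<close> is the integer part of the binary logarithm of
      \<open>card E\<close>.\<close>
    obtain d where d: "2 ^ d \<le> card E" "card E < 2 ^ Suc d"
      using ex_power_ivl1[of 2 "card E"] G(2) by auto
    let ?K = "finite_action.kernel_on G act E"
    obtain k where "(derived G ^^ k) (carrier G) \<subseteq> ?K" using G(3) by blast
    then have "card (carrier G) \<le> card E * (\<Prod>j<d. card E - 2 ^ j) * card ?K"
      by (rule finite_action.card_le_primitive_solvable[OF G(1) _ G(2,4) d])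
    then have "real (card (carrier G)) \<le> real (card E * (\<Prod>j<d. card E - 2 ^ j) * card ?K)"
      by (rule of_nat_mono)
    also have "\<dots> = real (card E * (\<Prod>j<d. card E - 2 ^ j)) * real (card ?K)"
      by (rule of_nat_mult)
    also have "\<dots> \<le> lambda ^ (card E - 1) * real (card ?K)"
      by (intro mult_right_mono prod_power_bound_lambda d) simp
    finally show "real (card (carrier G)) \<le> lambda ^ (card E - 1) * real (card ?K)" .
  qed (use assms(3) in auto)
  then show ?thesis by (simp add: img)
qed

lemma (in group) card_rcosets_le:
  fixes b :: real
  assumes "finite (carrier G)" "subgroup N G" "card (carrier G) \<le> b * card N"
  shows "card (rcosets N) \<le> b"
proof -
  have "finite N" using assms subgroup.subset finite_subset by blast
  then have "0 < real (card N)" using subgroup.one_closed[OF assms(2)] by (auto simp: card_gt_0_iff)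
  moreover have "real (card (rcosets N)) * card N \<le> b * card N"
    using assms lagrange[OF assms(2)] by (metis of_nat_mult order_def)
  ultimately show ?thesis by (simp add: mult_le_cancel_right)
qed

theorem theorem2:
  fixes \<Omega> :: "'a set" and n :: nat and H :: "('a \<Rightarrow> 'a) set" and G :: "('a \<Rightarrow> 'a) monoid"
  assumes "finite \<Omega>" and "card \<Omega> = n" and "n \<ge> 1"
    and "subgroup H (BijGroup \<Omega>)"
    and "G = (BijGroup \<Omega>)\<lparr>carrier := H\<rparr>"
  shows "card (rcosets\<^bsub>G\<^esub> (nilpotent_residual G)) \<le> 2 ^ (n - 1) \<and>
         real (card (rcosets\<^bsub>G\<^esub> (solvable_residual G))) \<le> lambda ^ (n - 1)"
proof -
  let ?N = "nilpotent_residual G" and ?S = "solvable_residual G"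
  have act: "finite_action G \<Omega> (\<lambda>g. g)"
    unfolding assms(5) by (rule permutation_group_action[OF assms(1,4)])
  interpret finite_action G \<Omega> "\<lambda>g. g" by (rule act)
  have "kernel_on \<Omega> \<subseteq> {\<one>\<^bsub>G\<^esub>}"
    using permutation_group_kernel[OF assms(1,4)] by (simp add: assms(5))
  \<comment> \<open>A faithful action has trivial kernel, so both residuals contain it, as the
    bounds for actions require.\<close>
  then have ker: "kernel_on \<Omega> \<subseteq> M" if "M \<lhd> G" for M
    using subgroup.one_closed[OF normal_imp_subgroup[OF that]] by blast
  have ne: "\<Omega> \<noteq> {}" using assms(2,3) by auto
  have N: "?N \<lhd> G" by (rule nilpotent_residual_normal[OF finite_carrier])
  obtain k where "lower_central G k \<subseteq> ?N"
    using nilpotent_Mod_residual[OF finite_carrier] nilpotent_Mod_iff[OF N] by blast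
  then have "card (carrier G) \<le> 2 ^ (n - 1) * card ?N"
    using card_le_nilpotent[OF act N _ ker[OF N] ne] assms(2) by blast
  then have "real (card (carrier G)) \<le> 2 ^ (n - 1) * real (card ?N)"
    using of_nat_mono by fastforce
  then have "real (card (rcosets\<^bsub>G\<^esub> ?N)) \<le> 2 ^ (n - 1)"
    by (rule card_rcosets_le[OF finite_carrier normal_imp_subgroup[OF N]])
  then have "real (card (rcosets\<^bsub>G\<^esub> ?N)) \<le> real (2 ^ (n - 1))" by simp
  then have 1: "card (rcosets\<^bsub>G\<^esub> ?N) \<le> 2 ^ (n - 1)" by (simp only: of_nat_le_iff)
  have S: "?S \<lhd> G" by (rule solvable_residual_normal[OF finite_carrier])
  obtain k where "(derived G ^^ k) (carrier G) \<subseteq> ?S"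
    using solvable_Mod_residual[OF finite_carrier] solvable_Mod_iff[OF S] by blast
  then have "card (carrier G) \<le> lambda ^ (n - 1) * card ?S"
    using card_le_solvable[OF act S _ ker[OF S] ne] assms(2) by blast
  then have "real (card (rcosets\<^bsub>G\<^esub> ?S)) \<le> lambda ^ (n - 1)"
    by (rule card_rcosets_le[OF finite_carrier normal_imp_subgroup[OF S]])
  then show ?thesis using 1 by blast
qed

end
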